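(* Let $n \ge 6$ be a natural number and let $S$ be a set of $$\binom{2n-6}{n-3}+\binom{2n-6}{n-4}-\binom{2n-8}{n-5}+1$$ points in the plane, non-vertical and in general position. Then $S$ contains an $(n-1)$-cap or $n$ points in convex position.
   Context: A set is in general position if no three of its points are collinear, and non-vertical if no vertical line contains two of its points. Points $(x_1,y_1),\dots,(x_k,y_k)$ form a $k$-cap if $x_1<\dots<x_k$ and the slopes $\frac{y_{i+1}-y_i}{x_{i+1}-x_i}$ are strictly decreasing in $i$. (In the paper the number of points is written as $f(n-1,n-1)+g(n,n-2)+1$, where $f(m,l)=\binom{m+l-4}{l-2}$ is the maximum size of a set with no $m$-cup and no $l$-cap, and $g(m,l)=\binom{m+l-4}{l-2}-\binom{m+l-6}{l-3}$.) *)

theory Defs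
  imports "HOL-Analysis.Analysis"
begin

definition general_position :: "(real \<times> real) set \<Rightarrow> bool" where
  "general_position S \<longleftrightarrow>
    (\<forall>p\<in>S. \<forall>q\<in>S. \<forall>r\<in>S. p \<noteq> q \<and> q \<noteq> r \<and> p \<noteq> r \<longrightarrow> \<not> collinear {p, q, r})"

definition non_vertical :: "(real \<times> real) set \<Rightarrow> bool" where
  "non_vertical S \<longleftrightarrow> (\<forall>p\<in>S. \<forall>q\<in>S. p \<noteq> q \<longrightarrow> fst p \<noteq> fst q)"

definition slope :: "real \<times> real \<Rightarrow> real \<times> real \<Rightarrow> real" where
  "slope p q = (snd q - snd p) / (fst q - fst p)"

text \<open>The points of a cap are listed from left to right and indexed from 0.\<close>

definition is_cap :: "nat \<Rightarrow> (real \<times> real) list \<Rightarrow> bool" where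
  "is_cap k ps \<longleftrightarrow> length ps = k \<and>
    (\<forall>i j. i < j \<and> j < k \<longrightarrow> fst (ps ! i) < fst (ps ! j)) \<and>
    (\<forall>i j. i < j \<and> Suc j < k \<longrightarrow>
       slope (ps ! j) (ps ! Suc j) < slope (ps ! i) (ps ! Suc i))"

definition convex_position :: "(real \<times> real) set \<Rightarrow> bool" where
  "convex_position P \<longleftrightarrow> (\<forall>p\<in>P. p \<notin> convex hull (P - {p}))"

end

theory Submission
  imports Defs
begin

text \<open>Suppose that there is neither an \<open>(n - 1)\<close>-cap nor a convex \<open>n\<close>-gon. Let \<open>S1\<close> be the set of left
  endpoints of \<open>(n - 2)\<close>-caps in \<open>S\<close>, and \<open>S2\<close> the set of right endpoints of \<open>(n - 2)\<close>-cups in \<open>S1\<close>.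
  The usual argument at a common endpoint shows that \<open>S1\<close> has no \<open>(n - 1)\<close>-cup and \<open>S2\<close> has no
  \<open>(n - 2)\<close>-cap. The new point is that \<open>S2\<close> has no \<open>(n - 2)\<close>-cup either, because an \<open>(n - 1)\<close>-cup together
  with a point above its chord is a convex \<open>n\<close>-gon. The cups-caps theorem, applied to \<open>S - S1\<close>,
  \<open>S1 - S2\<close> and \<open>S2\<close>, then gives
  \<open>f(n, n - 2) + f(n - 2, n - 1) + f(n - 2, n - 2)\<close> as an upper bound for the size of \<open>S\<close>, and by Pascal's
  rule this is one less than the assumed size.\<close>

section \<open>Chains: one notion for cups and caps\<close>

text \<open>\<open>T\<close> is tested on consecutive triples only, so prolonging a chain at either
  end costs one new triple. With \<open>T\<close> left open, cups and caps share the list lemmas and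
  the counting theorem.\<close>

fun chain :: "(real \<times> real \<Rightarrow> real \<times> real \<Rightarrow> real \<times> real \<Rightarrow> bool) \<Rightarrow> (real \<times> real) list \<Rightarrow> bool" where
  "chain T [] \<longleftrightarrow> True"
| "chain T [x] \<longleftrightarrow> True"
| "chain T [x, y] \<longleftrightarrow> fst x < fst y"
| "chain T (x # y # z # zs) \<longleftrightarrow> fst x < fst y \<and> T x y z \<and> chain T (y # z # zs)"

definition chain_free ::
  "(real \<times> real \<Rightarrow> real \<times> real \<Rightarrow> real \<times> real \<Rightarrow> bool) \<Rightarrow> nat \<Rightarrow> (real \<times> real) set \<Rightarrow> bool" where
  "chain_free T k S \<longleftrightarrow> (\<forall>xs. set xs \<subseteq> S \<and> length xs = k \<longrightarrow> \<not> chain T xs)"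

definition cup :: "real \<times> real \<Rightarrow> real \<times> real \<Rightarrow> real \<times> real \<Rightarrow> bool" where
  "cup p q r \<longleftrightarrow> slope p q < slope q r"

definition cap :: "real \<times> real \<Rightarrow> real \<times> real \<Rightarrow> real \<times> real \<Rightarrow> bool" where
  "cap p q r \<longleftrightarrow> slope q r < slope p q"

lemma chain_freeD: "chain_free T k S \<Longrightarrow> chain T xs \<Longrightarrow> set xs \<subseteq> S \<Longrightarrow> length xs \<noteq> k"
  unfolding chain_free_def by blast

lemma chain_free_subset: "chain_free T k S \<Longrightarrow> A \<subseteq> S \<Longrightarrow> chain_free T k A"
  unfolding chain_free_def by blast

lemma chain_Cons_less: "chain T (x # y # zs) \<Longrightarrow> fst x < fst y"
  by (cases zs) auto

lemma chain_tl: "chain T (x # xs) \<Longrightarrow> chain T xs"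
  by (cases xs rule: remdups_adj.cases) auto

lemma chain_Cons: "chain T (y # z # zs) \<Longrightarrow> fst x < fst y \<Longrightarrow> T x y z \<Longrightarrow> chain T (x # y # z # zs)"
  by simp

lemma chain_snoc:
  assumes "chain T (us @ [y, p])" "fst p < fst z" "T y p z"
  shows "chain T (us @ [y, p, z])"
  using assms
proof (induction us)
  case (Cons u us)
  then have "chain T (us @ [y, p, z])" using chain_tl by auto
  with Cons show ?case by (cases us rule: remdups_adj.cases) auto
qed auto

lemma chain_append1: "chain T (us @ vs) \<Longrightarrow> chain T us"
proof (induction us)
  case (Cons u us)
  then have "chain T us" using chain_tl by auto
  with Cons show ?case by (cases us rule: remdups_adj.cases; cases vs) auto
qed auto

lemma chain_append2: "chain T (us @ vs) \<Longrightarrow> chain T vs"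
proof (induction us)
  case (Cons u us)
  then show ?case using chain_tl[of T u "us @ vs"] by simp
qed simp

lemma chain_hd_less: "chain T (x # xs) \<Longrightarrow> y \<in> set xs \<Longrightarrow> fst x < fst y"
proof (induction xs arbitrary: x)
  case (Cons a xs)
  have "fst x < fst a" using Cons.prems(1) by (rule chain_Cons_less)
  moreover have "chain T (a # xs)" using Cons.prems(1) by (rule chain_tl)
  ultimately show ?case using Cons.IH[of a] Cons.prems(2) by (cases "y = a") auto
qed simp

lemma chain_sorted: "chain T xs \<Longrightarrow> sorted_wrt (\<lambda>x y. fst x < fst y) xs"
proof (induction xs)
  case (Cons x xs)
  then show ?case using chain_tl[OF Cons.prems] chain_hd_less[OF Cons.prems] by simp
qed simp

lemma chain_distinct: "chain T xs \<Longrightarrow> distinct xs"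
proof (induction xs)
  case (Cons x xs)
  then show ?case using chain_tl[OF Cons.prems] chain_hd_less[OF Cons.prems, of x] by auto
qed simp

lemma split_last2: "2 \<le> length xs \<Longrightarrow> \<exists>us y p. xs = us @ [y, p]"
proof -
  assume "2 \<le> length xs"
  then obtain ys p where "xs = ys @ [p]" by (cases xs rule: rev_cases) auto
  moreover with \<open>2 \<le> length xs\<close> obtain us y where "ys = us @ [y]" by (cases ys rule: rev_cases) auto
  ultimately show ?thesis by auto
qed

lemma split_first2: "2 \<le> length xs \<Longrightarrow> \<exists>x y zs. xs = x # y # zs"
  by (auto simp: numeral_2_eq_2 Suc_le_length_iff)

lemma split_first3: "3 \<le> length xs \<Longrightarrow> \<exists>x y z zs. xs = x # y # z # zs"
  by (auto simp: numeral_3_eq_3 Suc_le_length_iff)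

text \<open>At a common point, a left-going \<open>T\<close>-chain and a right-going \<open>T'\<close>-chain cannot both be
  maximal: the triple around the point extends one of them.\<close>

lemma chain_extension:
  assumes dich: "\<And>x y z. x \<in> S \<Longrightarrow> y \<in> S \<Longrightarrow> z \<in> S \<Longrightarrow> fst x < fst y \<Longrightarrow> fst y < fst z \<Longrightarrow> T x y z \<or> T' x y z"
    and xs: "chain T xs" "set xs \<subseteq> S" "length xs = k" "2 \<le> k"
    and ys: "chain T' ys" "set ys \<subseteq> S" "length ys = j" "2 \<le> j"
    and eq: "last xs = hd ys"
    and free: "chain_free T' (Suc j) S"
  obtains z where "z \<in> set ys" "chain T (xs @ [z])"
proof -
  obtain us y p where us: "xs = us @ [y, p]" using split_last2 xs by metis
  obtain z zs where zs: "ys = p # z # zs" using split_first2[of ys] ys eq us by auto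
  have yp: "fst y < fst p" using chain_append2 xs(1) us by fastforce
  have pz: "fst p < fst z" using chain_Cons_less ys(1) zs by blast
  have "\<not> T' y p z"
  proof
    assume "T' y p z"
    then have "chain T' (y # ys)" using chain_Cons yp ys(1) zs by blast
    then show False using chain_freeD[OF free, of "y # ys"] ys us xs(2) by auto
  qed
  then have "T y p z" using dich[of y p z] yp pz us zs xs(2) ys(2) by auto
  then have "chain T (xs @ [z])" using chain_snoc[of T us y p z] us xs(1) pz by simp
  then show ?thesis using that[of z] zs by simp
qed

section \<open>The cups-caps theorem of Erdos and Szekeres\<close>

lemma card_le_1_if_chain_free_2:
  assumes "finite S" "inj_on fst S" "chain_free T 2 S"
  shows "card S \<le> 1"
proof (rule ccontr)
  assume "\<not> card S \<le> 1"
  then obtain x y where xy: "x \<in> S" "y \<in> S" "x \<noteq> y"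
    using card_le_Suc0_iff_eq[OF assms(1)] by auto
  then have "fst x \<noteq> fst y" using assms(2) by (auto dest: inj_onD)
  then have "chain T [x, y] \<or> chain T [y, x]" by auto
  then show False using chain_freeD[OF assms(3)] xy by fastforce
qed

lemma card_split_subset: "finite S \<Longrightarrow> A \<subseteq> S \<Longrightarrow> card S = card A + card (S - A)"
  by (metis card_Diff_subset card_mono finite_subset le_add_diff_inverse)

text \<open>Induction on \<open>m + l\<close>; both sizes are shifted by two to keep the binomial
  free of subtraction. Set aside the right endpoints of the \<open>T\<close>-chains with one point
  fewer than forbidden: the remaining points lose one in the \<open>T\<close>-size, the endpoints
  lose one in the \<open>T'\<close>-size by \<open>chain_extension\<close>, and the two bounds add
  up by Pascal's rule.\<close>

theorem cups_caps_bound: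
  assumes "finite S" "inj_on fst S"
    and "\<And>x y z. x \<in> S \<Longrightarrow> y \<in> S \<Longrightarrow> z \<in> S \<Longrightarrow> fst x < fst y \<Longrightarrow> fst y < fst z \<Longrightarrow> T x y z \<or> T' x y z"
    and "chain_free T (m + 2) S" "chain_free T' (l + 2) S"
  shows "card S \<le> (m + l) choose l"
  using assms
proof (induction "m + l" arbitrary: m l S)
  case 0
  then have "chain_free T 2 S" by (simp add: numeral_2_eq_2)
  then have "card S \<le> 1" using card_le_1_if_chain_free_2 "0.prems"(1,2) by blast
  then show ?case using 0 by simp
next
  case (Suc k)
  show ?case
  proof (cases "m = 0 \<or> l = 0")
    case True
    have "chain_free T 2 S \<or> chain_free T' 2 S" using True Suc.prems(4,5) by (auto simp: numeral_2_eq_2)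
    then have "card S \<le> 1" using card_le_1_if_chain_free_2[OF Suc.prems(1,2)] by blast
    then show ?thesis using True by auto
  next
    case False
    then obtain m' l' where ml: "m = Suc m'" "l = Suc l'" by (cases m; cases l) auto
    define A where "A = {p \<in> S. \<exists>xs. set xs \<subseteq> S \<and> length xs = m' + 2 \<and> chain T xs \<and> last xs = p}"
    have AS: "A \<subseteq> S" unfolding A_def by auto
    have fin: "finite A" "inj_on fst A" "finite (S - A)" "inj_on fst (S - A)"
      using finite_subset[OF AS Suc.prems(1)] inj_on_subset[OF Suc.prems(2) AS]
        finite_Diff[OF Suc.prems(1)] inj_on_diff[OF Suc.prems(2)] by simp_all
    have freeSA: "chain_free T (m' + 2) (S - A)"
      unfolding chain_free_def
    proof (intro allI impI notI)
      fix xs assume xs: "set xs \<subseteq> S - A \<and> length xs = m' + 2" "chain T xs"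
      then have "last xs \<in> set xs" by (intro last_in_set) auto
      then show False using xs A_def by blast
    qed
    have freeA: "chain_free T' (l' + 2) A"
      unfolding chain_free_def
    proof (intro allI impI notI)
      fix ys assume ys: "set ys \<subseteq> A \<and> length ys = l' + 2" "chain T' ys"
      then have "hd ys \<in> A" using hd_in_set[of ys] by fastforce
      then obtain xs where xs: "set xs \<subseteq> S" "length xs = m' + 2" "chain T xs" "last xs = hd ys"
        unfolding A_def by blast
      have ysS: "set ys \<subseteq> S" using ys(1) AS by blast
      have free: "chain_free T' (Suc (l' + 2)) S" using Suc.prems(5) ml by simp
      obtain z where z: "z \<in> set ys" "chain T (xs @ [z])"
        by (rule chain_extension[OF Suc.prems(3) xs(3,1,2) _ ys(2) ysS conjunct2[OF ys(1)] _ xs(4) free]) simp_all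
      have "set (xs @ [z]) \<subseteq> S" using xs(1) ysS z(1) by auto
      from chain_freeD[OF Suc.prems(4) z(2) this] show False using xs(2) ml by simp
    qed
    have "card (S - A) \<le> (m' + l) choose l"
    proof (rule Suc.hyps(1))
      show "k = m' + l" using Suc.hyps(2) ml by simp
      show "T x y z \<or> T' x y z" if "x \<in> S - A" "y \<in> S - A" "z \<in> S - A" "fst x < fst y" "fst y < fst z" for x y z
        using Suc.prems(3) that by blast
      show "chain_free T' (l + 2) (S - A)" using chain_free_subset Suc.prems(5) by blast
    qed (rule fin freeSA)+
    moreover have "card A \<le> (m + l') choose l'"
    proof (rule Suc.hyps(1))
      show "k = m + l'" using Suc.hyps(2) ml by simp
      show "T x y z \<or> T' x y z" if "x \<in> A" "y \<in> A" "z \<in> A" "fst x < fst y" "fst y < fst z" for x y z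
        using Suc.prems(3) that AS by blast
      show "chain_free T (m + 2) A" using chain_free_subset Suc.prems(4) AS by blast
    qed (rule fin freeA)+
    moreover have "card S = card A + card (S - A)"
      using card_split_subset Suc.prems(1) AS by blast
    moreover have "(m + l) choose l = ((m' + l) choose l) + ((m + l') choose l')"
      using binomial_Suc_Suc[of "m' + l" l'] ml by simp
    ultimately show ?thesis by linarith
  qed
qed

section \<open>Slopes and supporting lines\<close>

text \<open>\<open>slope p r\<close> is the mean of the other two slopes weighted by horizontal
  distances, so it lies strictly between them.\<close>

lemma slope_between:
  assumes "fst p < fst q" "fst q < fst r"
  shows "slope p q < slope q r \<Longrightarrow> slope p q < slope p r"
    and "slope p q < slope q r \<Longrightarrow> slope p r < slope q r"
    and "slope q r < slope p q \<Longrightarrow> slope p r < slope p q"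
    and "slope q r < slope p q \<Longrightarrow> slope q r < slope p r"
proof -
  have *: "slope p q * (fst q - fst p) = snd q - snd p" "slope q r * (fst r - fst q) = snd r - snd q"
    "slope p r * (fst r - fst p) = snd r - snd p"
    using assms by (auto simp: slope_def)
  then have eq: "(slope p r - slope p q) * (fst r - fst p) = (slope q r - slope p q) * (fst r - fst q)"
    "(slope q r - slope p r) * (fst r - fst p) = (slope q r - slope p q) * (fst q - fst p)"
    by algebra+
  have pos: "fst r - fst p > 0" "fst r - fst q > 0" "fst q - fst p > 0" using assms by auto
  { assume "slope p q < slope q r"
    then have "(slope p r - slope p q) * (fst r - fst p) > 0" "(slope q r - slope p r) * (fst r - fst p) > 0"
      unfolding eq using pos by simp_all
    then show "slope p q < slope p r" "slope p r < slope q r"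
      using pos by (auto simp: zero_less_mult_iff) }
  { assume "slope q r < slope p q"
    then have "(slope p r - slope p q) * (fst r - fst p) < 0" "(slope q r - slope p r) * (fst r - fst p) < 0"
      unfolding eq using pos by (simp_all add: mult_less_0_iff)
    then show "slope p r < slope p q" "slope q r < slope p r"
      using pos by (auto simp: mult_less_0_iff) }
qed

text \<open>This turns general position into the dichotomy that every triple is a cup or a
  cap.\<close>

lemma collinear_if_slope_eq:
  assumes "fst p < fst q" "fst q < fst r" "slope p q = slope q r"
  shows "collinear {p, q, r}"
proof -
  define c where "c = - ((fst r - fst q) / (fst q - fst p))"
  have c: "c * (fst p - fst q) = fst r - fst q" using assms(1) unfolding c_def by (simp add: field_simps)
  have "snd p - snd q = slope p q * (fst p - fst q)" "snd r - snd q = slope q r * (fst r - fst q)"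
    using assms(1,2) by (auto simp: slope_def field_simps)
  then have "c * (snd p - snd q) = snd r - snd q" using c assms(3) by (metis mult.left_commute)
  then have "r - q = c *\<^sub>R (p - q)" using c by (simp add: prod_eq_iff)
  then have "collinear {0, p - q, r - q}" unfolding collinear_lemma by blast
  then show ?thesis by (subst collinear_3) auto
qed

text \<open>All edges from \<open>x\<close> rightwards are steeper than \<sigma>. The induction
  moves the base point from \<open>x\<close> to \<open>b\<close> and adds the inequality of the
  first edge to that of the remaining path.\<close>

lemma above_line_right:
  assumes "chain cup (x # b # vs)" "\<sigma> < slope x b" "r \<in> set (b # vs)"
  shows "snd r - snd x > \<sigma> * (fst r - fst x)"
  using assms
proof (induction vs arbitrary: x b)
  case Nil
  then show ?case by (auto simp: slope_def field_simps)
next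
  case (Cons c vs)
  have lt: "fst x < fst b" and ch: "chain cup (b # c # vs)" and "cup x b c"
    using Cons.prems(1) by auto
  then have "\<sigma> < slope b c" using Cons.prems(2) by (simp add: cup_def)
  have b: "snd b - snd x > \<sigma> * (fst b - fst x)"
    using Cons.prems(2) lt by (auto simp: slope_def field_simps)
  show ?case
  proof (cases "r = b")
    case False
    then have "snd r - snd b > \<sigma> * (fst r - fst b)"
      using Cons.IH[OF ch \<open>\<sigma> < slope b c\<close>] Cons.prems(3) by auto
    then show ?thesis using b by (simp add: algebra_simps)
  qed (use b in auto)
qed

lemma above_line_left:
  assumes "chain cup (us @ [a, x])" "slope a x < \<sigma>" "r \<in> set (us @ [a])"
  shows "snd r - snd x > \<sigma> * (fst r - fst x)"
  using assms
proof (induction us arbitrary: a x rule: rev_induct)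
  case Nil
  then show ?case by (auto simp: slope_def field_simps)
next
  case (snoc c us)
  have ch: "chain cup (us @ [c, a])" using chain_append1[of cup "us @ [c, a]" "[x]"] snoc.prems by simp
  have "chain cup [c, a, x]" using chain_append2[of cup us "[c, a, x]"] snoc.prems(1) by simp
  then have lt: "fst a < fst x" and "slope c a < \<sigma>"
    using snoc.prems(2) by (auto simp: cup_def)
  have a: "snd a - snd x > \<sigma> * (fst a - fst x)"
    using snoc.prems(2) lt by (auto simp: slope_def field_simps)
  show ?case
  proof (cases "r = a")
    case False
    then have "snd r - snd a > \<sigma> * (fst r - fst a)"
      using snoc.IH[OF ch \<open>slope c a < \<sigma>\<close>] snoc.prems(3) by auto
    then show ?thesis using a by (simp add: algebra_simps)
  qed (use a in auto)
qed

text \<open>Any slope strictly between those of the two edges at the inner vertex \<open>x\<close>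
  works.\<close>

lemma cup_supporting_line:
  assumes "chain cup (us @ x # vs)" "us \<noteq> []" "vs \<noteq> []"
  obtains \<sigma> where "\<And>r. r \<in> set (us @ vs) \<Longrightarrow> snd r - snd x > \<sigma> * (fst r - fst x)"
proof -
  obtain us' a where us: "us = us' @ [a]" using assms(2) rev_exhaust by blast
  obtain b vs' where vs: "vs = b # vs'" using assms(3) list.exhaust by blast
  have "chain cup (a # x # b # vs')" using chain_append2[of cup us' "a # x # b # vs'"] assms(1) us vs by simp
  then have "cup a x b" and right: "chain cup (x # b # vs')" by auto
  then obtain \<sigma> where \<sigma>: "slope a x < \<sigma>" "\<sigma> < slope x b" unfolding cup_def using dense by blast
  have left: "chain cup (us' @ [a, x])" using chain_append1[of cup "us' @ [a, x]"] assms(1) us by simp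
  show ?thesis
    using that[of \<sigma>] above_line_left[OF left \<sigma>(1)] above_line_right[OF right \<sigma>(2)] us vs by auto
qed

section \<open>Convex position of a cup with at most one point above its chord\<close>

lemma not_in_convex_hull_if_separated:
  fixes p :: "real \<times> real"
  assumes "\<And>r. r \<in> R \<Longrightarrow> A * fst r + B * snd r > A * fst p + B * snd p"
  shows "p \<notin> convex hull R"
proof -
  let ?H = "{r. (A, B) \<bullet> r > (A, B) \<bullet> p}"
  have "R \<subseteq> ?H" using assms by (auto simp: inner_prod_def)
  then have "convex hull R \<subseteq> ?H" by (intro hull_minimal convex_halfspace_gt)
  then show ?thesis by auto
qed

text \<open>\<open>Y\<close> may be empty, so that plain cups are covered as well. Every point gets
  its own separating line: a vertical one at the two ends, a supporting line at an inner vertex of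
  the cup, and the chord for the point of \<open>Y\<close>.\<close>

lemma convex_position_cup_above:
  assumes ch: "chain cup xs" and ne: "xs \<noteq> []"
    and Y: "\<And>y. y \<in> Y \<Longrightarrow> fst (hd xs) < fst y \<and> fst y < fst (last xs) \<and> cap (hd xs) y (last xs)"
    and single: "Y \<subseteq> {y}"
  shows "convex_position (Y \<union> set xs)"
  unfolding convex_position_def
proof
  fix p assume p: "p \<in> Y \<union> set xs"
  let ?R = "Y \<union> set xs - {p}"
  let ?a = "hd xs" and ?w = "last xs"
  have a_min: "fst ?a < fst r" if "r \<in> Y \<union> set xs" "r \<noteq> ?a" for r
  proof (cases "r \<in> Y")
    case False
    then have "r \<in> set (tl xs)" using that ne by (cases xs) auto
    then show ?thesis using chain_hd_less[of cup ?a "tl xs" r] ch ne by simp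
  qed (use Y in auto)
  have w_max: "fst r < fst ?w" if "r \<in> Y \<union> set xs" "r \<noteq> ?w" for r
  proof (cases "r \<in> Y")
    case False
    obtain us where us: "xs = us @ [?w]" using ne append_butlast_last_id by metis
    have "sorted_wrt (\<lambda>x y. fst x < fst y) (us @ [?w])" using chain_sorted ch us by metis
    moreover have "r \<in> set us" using False that us
      by (metis Un_iff rotate1.simps(2) set_ConsD set_rotate1)
    ultimately show ?thesis by (simp add: sorted_wrt_append)
  qed (use Y in auto)
  show "p \<notin> convex hull ?R"
  proof (cases "p = ?a \<or> p = ?w")
    case True
    then show ?thesis
    proof
      assume "p = ?a"
      then show ?thesis
        by (intro not_in_convex_hull_if_separated[of _ 1 _ 0]) (use a_min in auto)
    next
      assume "p = ?w"
      then show ?thesis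
        by (intro not_in_convex_hull_if_separated[of _ "- 1" _ 0]) (use w_max in auto)
    qed
  next
    case False
    \<comment> \<open>If \<open>y\<close> were on or under a line that passes strictly below both
      ends, the slope into \<open>y\<close> would be less than \<sigma> and the slope out of it
      greater, against \<open>cap\<close>.\<close>
    have chord: "snd y - snd x > \<sigma> * (fst y - fst x)"
      if "y \<in> Y" "snd ?a - snd x > \<sigma> * (fst ?a - fst x)" "snd ?w - snd x > \<sigma> * (fst ?w - fst x)" for y x \<sigma>
    proof (rule ccontr)
      assume neg: "\<not> ?thesis"
      have lt: "fst ?a < fst y" "fst y < fst ?w" "slope y ?w < slope ?a y"
        using Y[OF that(1)] by (auto simp: cap_def)
      have "slope ?a y * (fst y - fst ?a) = snd y - snd ?a" using lt by (simp add: slope_def)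
      also have "\<dots> < \<sigma> * (fst y - fst ?a)" using neg that(2) by (simp add: algebra_simps)
      finally have 1: "slope ?a y < \<sigma>" using lt by simp
      have "\<sigma> * (fst ?w - fst y) < snd ?w - snd y" using neg that(3) by (simp add: algebra_simps)
      also have "\<dots> = slope y ?w * (fst ?w - fst y)" using lt by (simp add: slope_def)
      finally have "\<sigma> < slope y ?w" using lt by simp
      then show False using 1 lt by simp
    qed
    have support: "\<exists>\<sigma>. \<forall>r \<in> Y \<union> set xs - {x}. snd r - snd x > \<sigma> * (fst r - fst x)"
      if x: "x \<in> set xs" "x \<noteq> ?a" "x \<noteq> ?w" for x
    proof -
      obtain us vs where xs: "xs = us @ x # vs" using x(1) split_list by metis
      have "us \<noteq> []" "vs \<noteq> []" using x xs by auto
      then obtain \<sigma> where \<sigma>: "\<And>r. r \<in> set (us @ vs) \<Longrightarrow> snd r - snd x > \<sigma> * (fst r - fst x)"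
        using cup_supporting_line ch xs by metis
      have "?a \<in> set (us @ vs)" "?w \<in> set (us @ vs)" using \<open>us \<noteq> []\<close> \<open>vs \<noteq> []\<close> xs by auto
      then have "snd y - snd x > \<sigma> * (fst y - fst x)" if "y \<in> Y" for y
        using chord that \<sigma> by blast
      then have "\<forall>r \<in> Y \<union> set xs - {x}. snd r - snd x > \<sigma> * (fst r - fst x)" using \<sigma> xs by auto
      then show ?thesis by blast
    qed
    show ?thesis
    proof (cases "p \<in> set xs")
      case True
      then obtain \<sigma> where "\<forall>r \<in> ?R. snd r - snd p > \<sigma> * (fst r - fst p)"
        using support False by blast
      then show ?thesis
        by (intro not_in_convex_hull_if_separated[of _ "- \<sigma>" _ 1]) (auto simp: algebra_simps)
    next
      case p_notin: False
      then have pY: "p \<in> Y" and R: "?R = set xs" using p single by auto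
      define \<sigma> where "\<sigma> = slope ?a ?w"
      have lt: "fst ?a < fst p" "fst p < fst ?w" and "slope p ?w < slope ?a p"
        using Y[OF pY] by (auto simp: cap_def)
      then have "\<sigma> < slope ?a p" unfolding \<sigma>_def using slope_between(3) by blast
      then have above: "snd p - snd ?a > \<sigma> * (fst p - fst ?a)"
        using lt(1) by (simp add: slope_def field_simps)
      have aw: "snd ?w - snd ?a = \<sigma> * (fst ?w - fst ?a)"
        using lt unfolding \<sigma>_def by (simp add: slope_def)
      have below: "snd r - snd ?a \<le> \<sigma> * (fst r - fst ?a)" if r: "r \<in> set xs" for r
      proof (cases "r = ?a \<or> r = ?w")
        case True
        then show ?thesis using aw by auto
      next
        case False
        \<comment> \<open>The supporting line at \<open>r\<close> passes below both ends, so the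
          slope from \<open>?a\<close> to \<open>r\<close> is less than that from \<open>r\<close>
          to \<open>?w\<close>, which puts \<open>r\<close> under the chord.\<close>
        then obtain \<tau> where \<tau>: "\<forall>s \<in> Y \<union> set xs - {r}. snd s - snd r > \<tau> * (fst s - fst r)"
          using support r by blast
        have a: "snd ?a - snd r > \<tau> * (fst ?a - fst r)" and w: "snd ?w - snd r > \<tau> * (fst ?w - fst r)"
          using \<tau> False ne by auto
        have rlt: "fst ?a < fst r" "fst r < fst ?w" using a_min w_max r False by auto
        have "slope ?a r * (fst r - fst ?a) = snd r - snd ?a" using rlt by (simp add: slope_def)
        also have "\<dots> < \<tau> * (fst r - fst ?a)" using a by (simp add: algebra_simps)
        finally have "slope ?a r < \<tau>" using rlt by simp
        moreover have "\<tau> * (fst ?w - fst r) < slope r ?w * (fst ?w - fst r)"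
          using w rlt by (simp add: slope_def)
        ultimately have "slope ?a r < slope r ?w" using rlt by simp
        then have "slope ?a r < \<sigma>" unfolding \<sigma>_def using slope_between(1) rlt by blast
        then show ?thesis using rlt by (simp add: slope_def field_simps)
      qed
      have "p \<notin> convex hull (set xs)"
      proof (rule not_in_convex_hull_if_separated[of _ \<sigma> _ "- 1"])
        fix r assume "r \<in> set xs"
        then show "\<sigma> * fst r + - 1 * snd r > \<sigma> * fst p + - 1 * snd p"
          using below[of r] above by (simp add: algebra_simps)
      qed
      then show ?thesis using R by simp
    qed
  qed
qed

section \<open>Excluding an (n - 2)-cup in the innermost set\<close>

text \<open>Four chains with \<open>k = n - 2\<close> points are attached to
  the \<open>k\<close>-cup \<open>Q\<close>, which starts at \<open>q1\<close> and ends with the edge from \<open>t\<close> to \<open>q\<close>.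
  The cup ending at \<open>q1\<close> is forced to continue with the second point \<open>z\<close> of the cap at \<open>q\<close>; then the
  third point \<open>e\<close> of that cap lies below the line through \<open>t\<close> and \<open>q\<close>, so skipping \<open>z\<close> leaves
  room to extend the cap twice to the left.\<close>

lemma five_chains_contradiction:
  assumes dich: "\<And>x y z. x \<in> S \<Longrightarrow> y \<in> S \<Longrightarrow> z \<in> S \<Longrightarrow> fst x < fst y \<Longrightarrow> fst y < fst z \<Longrightarrow> cup x y z \<or> cap x y z"
    and inj: "inj_on fst S"
    and no_cup: "chain_free cup (k + 2) S" and no_cap: "chain_free cap (k + 1) S"
    and no_cup_above: "\<And>xs y. \<lbrakk>chain cup xs; set xs \<subseteq> S; length xs = k + 1; y \<in> S;
      fst (hd xs) < fst y; fst y < fst (last xs)\<rbrakk> \<Longrightarrow> \<not> cap (hd xs) y (last xs)"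
    and Q: "chain cup Q" "set Q \<subseteq> S" "length Q = k" "hd Q = q1" "Q = Q0 @ [t, q]"
    and C1: "chain cap C1" "set C1 \<subseteq> S" "length C1 = k" "hd C1 = q1"
    and C2: "chain cap C2" "set C2 \<subseteq> S" "length C2 = k" "hd C2 = q"
    and D1: "chain cup D1" "set D1 \<subseteq> S" "length D1 = k" "last D1 = q1"
    and D2: "chain cup D2" "set D2 \<subseteq> S" "length D2 = k" "last D2 = t"
    and k: "3 \<le> k"
  shows False
proof -
  obtain c c' Cs where C1': "C1 = q1 # c # c' # Cs" using split_first3[of C1] C1 k by auto
  obtain z e Es where C2': "C2 = q # z # e # Es" using split_first3[of C2] C2 k by auto
  obtain Ds D where D1': "D1 = Ds @ [D, q1]" using split_last2[of D1] D1 k by auto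
  obtain ds d where D2': "D2 = ds @ [d, t]" using split_last2[of D2] D2 k by auto
  have inS: "t \<in> S" "q \<in> S" "q1 \<in> S" "c \<in> S" "c' \<in> S" "z \<in> S" "e \<in> S" "D \<in> S" "d \<in> S"
    using Q C1 C2 D1 D2 C1' C2' D1' D2' by auto
  have c_lt: "fst q1 < fst c" "fst c < fst c'"
    using C1(1) C1' chain_Cons_less[of cap c c' Cs] by auto
  have e_lt: "fst q < fst z" "fst z < fst e"
    using C2(1) C2' chain_Cons_less[of cap z e Es] by auto
  have D_lt: "fst D < fst q1" using chain_append2[of cup Ds "[D, q1]"] D1(1) D1' by simp
  have d_lt: "fst d < fst t" using chain_append2[of cup ds "[d, t]"] D2(1) D2' by simp
  have t_lt: "fst t < fst q" using chain_append2[of cup Q0 "[t, q]"] Q(1,5) by simp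
  have q1q: "fst q1 < fst q"
  proof -
    obtain x xs where "Q0 @ [t, q] = x # xs" by (cases Q0) auto
    then have "Q = q1 # xs" "xs \<noteq> []" "last xs = q" using Q(4,5) k
      by (auto simp: append_eq_Cons_conv split: if_splits)
    then show ?thesis using chain_hd_less Q(1) last_in_set by blast
  qed
  have C1_cap: "cap q1 c c'" and C2_cap: "cap q z e" using C1(1) C2(1) C1' C2' by auto
  \<comment> \<open>Otherwise \<open>t # C2\<close> would be a (k + 1)-cap. The same argument
    applies to \<open>D\<close> and \<open>C1\<close> below.\<close>
  have "\<not> cap t q z"
    using chain_freeD[OF no_cap, of "t # C2"] chain_Cons[of cap q z "e # Es" t] C2 C2' t_lt inS by auto
  then have tqz: "cup t q z" using dich inS t_lt e_lt by blast
  have Qz: "chain cup (Q @ [z])" using chain_snoc[of cup Q0 t q z] Q e_lt tqz by simp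
  have "\<not> cap D q1 c"
    using chain_freeD[OF no_cap, of "D # C1"] chain_Cons[of cap q1 c "c' # Cs" D] C1 C1' D_lt inS by auto
  then have Dqc: "cup D q1 c" using dich inS D_lt c_lt by blast
  have Dc: "chain cup (Ds @ [D, q1, c])" using chain_snoc[of cup Ds D q1 c] D1 D1' c_lt Dqc by simp
  \<comment> \<open>The aim is to let \<open>D1\<close> continue with \<open>z\<close> in place of
    \<open>c\<close>; the order of \<open>z\<close> and \<open>c\<close> decides the
    argument.\<close>
  have Dqz: "cup D q1 z"
  proof (cases "fst z" "fst c" rule: linorder_cases)
    case equal
    then show ?thesis using inj inS Dqc by (auto dest: inj_onD)
  next
    case greater
    \<comment> \<open>Now \<open>c\<close> is in the horizontal range of the (k + 1)-cup
      \<open>Q @ [z]\<close>, so it cannot lie above its chord. But then \<open>D1\<close> would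
      continue with both \<open>c\<close> and \<open>z\<close>.\<close>
    have "hd (Q @ [z]) = q1" "last (Q @ [z]) = z" using Q(3,4) k by (auto simp: hd_append)
    then have "\<not> cap q1 c z"
      using no_cup_above[of "Q @ [z]" c] Qz Q inS greater c_lt by auto
    then have "cup q1 c z" using dich inS greater c_lt by blast
    then have "chain cup ((Ds @ [D]) @ [q1, c, z])"
      using chain_snoc[of cup "Ds @ [D]" q1 c z] Dc greater by simp
    then show ?thesis using chain_freeD[OF no_cup, of "(Ds @ [D]) @ [q1, c, z]"] D1 D1' inS by auto
  next
    case less
    \<comment> \<open>Since \<open>Q\<close> cannot continue with both \<open>z\<close> and
      \<open>c\<close>, and \<open>q, z\<close> cannot precede \<open>c # c' # Cs\<close> in a cap,
      the edge from \<open>z\<close> to \<open>c\<close> has smaller slope than the one from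
      \<open>c\<close> to \<open>c'\<close>, hence than the one from \<open>q1\<close> to
      \<open>c\<close>. So \<open>z\<close> is above the line through \<open>q1\<close> and
      \<open>c\<close>.\<close>
    have "\<not> cup q z c"
      using chain_freeD[OF no_cup, of "Q @ [z, c]"] chain_snoc[of cup "Q0 @ [t]" q z c] Qz Q less inS by auto
    then have qzc: "cap q z c" using dich inS e_lt less by blast
    have "\<not> cap z c c'"
      using chain_freeD[OF no_cap, of "q # z # c # c' # Cs"] chain_tl[of cap q1 "c # c' # Cs"]
        C1 C1' qzc less e_lt inS by auto
    then have "cup z c c'" using dich inS less c_lt by blast
    then have "slope z c < slope q1 c" using C1_cap by (simp add: cup_def cap_def)
    moreover have "fst q1 < fst z" using q1q e_lt by simp
    ultimately have "slope q1 c < slope q1 z"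
      using slope_between(2,3)[of q1 z c] dich[of q1 z c] less inS by (auto simp: cup_def cap_def)
    then show ?thesis using Dqc by (simp add: cup_def)
  qed
  have Dz: "chain cup (Ds @ [D, q1, z])"
    using chain_snoc[of cup Ds D q1 z] D1 D1' q1q e_lt Dqz by simp
  \<comment> \<open>\<open>D1\<close> already continues with \<open>z\<close> and cannot take
    \<open>e\<close> as well.\<close>
  have "\<not> cup q1 z e"
    using chain_freeD[OF no_cup, of "Ds @ [D, q1, z, e]"] chain_snoc[of cup "Ds @ [D]" q1 z e] Dz D1 D1' e_lt inS
    by auto
  then have qze: "cap q1 z e" using dich[of q1 z e] inS q1q e_lt by auto
  \<comment> \<open>Otherwise \<open>Q @ [e]\<close> would be a (k + 1)-cup with \<open>z\<close>
    above its chord.\<close>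
  have "\<not> cup t q e"
  proof
    assume "cup t q e"
    then have "chain cup (Q @ [e])" using chain_snoc[of cup Q0 t q e] Q e_lt by simp
    moreover have "hd (Q @ [e]) = q1" "last (Q @ [e]) = e" using Q(3,4) k by (auto simp: hd_append)
    ultimately show False
      using no_cup_above[of "Q @ [e]" z] Q inS e_lt q1q qze by auto
  qed
  then have tqe: "cap t q e" using dich[of t q e] inS t_lt e_lt by auto
  have "\<not> cup d t q"
  proof
    assume "cup d t q"
    then have "chain cup (ds @ [d, t, q])" using chain_snoc[of cup ds d t q] D2 D2' t_lt by simp
    then have "chain cup ((ds @ [d]) @ [t, q, z])"
      using chain_snoc[of cup "ds @ [d]" t q z] tqz e_lt by simp
    then show False using chain_freeD[OF no_cup, of "(ds @ [d]) @ [t, q, z]"] D2 D2' inS by auto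
  qed
  then have dtq: "cap d t q" using dich inS t_lt d_lt by blast
  have eEs: "chain cap (e # Es)" using C2(1) C2' chain_tl by metis
  \<comment> \<open>Dropping \<open>z\<close> keeps a cap: the slope from \<open>q\<close> to
    \<open>e\<close> exceeds that from \<open>z\<close> to \<open>e\<close>, which exceeds the next
    slope.\<close>
  have "chain cap (q # e # Es)"
  proof (cases Es)
    case (Cons e' Es')
    then have "slope e e' < slope z e" using C2(1) C2' by (simp add: cap_def)
    moreover have "slope z e < slope q e"
      using slope_between(4)[of q z e] e_lt C2_cap by (simp add: cap_def)
    ultimately have "cap q e e'" by (simp add: cap_def)
    then show ?thesis using chain_Cons eEs Cons e_lt by simp
  qed (use e_lt in simp)
  \<comment> \<open>One point of \<open>C2\<close> is lost and two are gained: a cap with k + 1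
    points.\<close>
  then have "chain cap (d # t # q # e # Es)" using chain_Cons tqe dtq t_lt d_lt by simp
  then show False using chain_freeD[OF no_cap, of "d # t # q # e # Es"] C2 C2' inS by auto
qed

section \<open>Return to lists of points, and the count over three pieces\<close>

text \<open>\<open>is_cap\<close> compares all pairs of edges, \<open>chain\<close> only
  neighbouring ones; transitivity closes the gap.\<close>

lemma is_cap_if_chain:
  assumes "chain cap ps" "length ps = k"
  shows "is_cap k ps"
proof -
  have consecutive: "slope (ps ! Suc i) (ps ! Suc (Suc i)) < slope (ps ! i) (ps ! Suc i)"
    if "chain cap ps" "Suc (Suc i) < length ps" for i ps
    using that
  proof (induction i arbitrary: ps)
    case 0
    then obtain x y z zs where "ps = x # y # z # zs" using split_first3[of ps] by auto
    then show ?case using 0 by (simp add: cap_def)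
  next
    case (Suc i)
    then obtain x xs where "ps = x # xs" by (cases ps) auto
    then show ?case using Suc.IH[of xs] Suc.prems chain_tl by auto
  qed
  have "slope (ps ! j) (ps ! Suc j) < slope (ps ! i) (ps ! Suc i)" if "i < j" "Suc j < k" for i j
    using that
  proof (induction j rule: less_induct)
    case (less j)
    then obtain j' where j: "j = Suc j'" by (cases j) auto
    have "slope (ps ! j) (ps ! Suc j) < slope (ps ! j') (ps ! Suc j')"
      using consecutive[of ps j'] assms less.prems j by simp
    then show ?case using less.IH[of j'] less.prems j by (cases "i = j'") auto
  qed
  moreover have "fst (ps ! i) < fst (ps ! j)" if "i < j" "j < k" for i j
    using chain_sorted[OF assms(1)] that assms(2) by (simp add: sorted_wrt_iff_nth_less)
  ultimately show ?thesis unfolding is_cap_def using assms(2) by blast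
qed

text \<open>Here n = k + 6, which avoids truncated subtraction; the summands are f(n, n - 2), f(n -
  2, n - 1) and f(n - 2, n - 2) in this order.\<close>

theorem card_bound_convex_position_free:
  assumes fin: "finite S" and inj: "inj_on fst S"
    and dich: "\<And>x y z. x \<in> S \<Longrightarrow> y \<in> S \<Longrightarrow> z \<in> S \<Longrightarrow> fst x < fst y \<Longrightarrow> fst y < fst z \<Longrightarrow> cup x y z \<or> cap x y z"
    and no_cap: "chain_free cap (k + 5) S"
    and no_convex: "\<And>P. P \<subseteq> S \<Longrightarrow> card P = k + 6 \<Longrightarrow> \<not> convex_position P"
  shows "card S \<le> ((2 * k + 6) choose (k + 2)) + ((2 * k + 5) choose (k + 3)) + ((2 * k + 4) choose (k + 2))"
proof -
  have no_cup: "chain_free cup (k + 6) S"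
    unfolding chain_free_def
  proof (intro allI impI notI)
    fix xs assume xs: "set xs \<subseteq> S \<and> length xs = k + 6" "chain cup xs"
    then have "convex_position ({} \<union> set xs)" by (intro convex_position_cup_above) auto
    moreover have "card (set xs) = k + 6" using xs chain_distinct distinct_card by metis
    ultimately show False using no_convex xs by auto
  qed
  have no_cap': "chain_free cap (Suc (k + 4)) S" using no_cap by (simp add: eval_nat_numeral)
  have no_cup_above: "\<not> cap (hd xs) y (last xs)"
    if xs: "chain cup xs" "set xs \<subseteq> S" "length xs = k + 5" "y \<in> S"
      "fst (hd xs) < fst y" "fst y < fst (last xs)" for xs y
  proof
    assume above: "cap (hd xs) y (last xs)"
    have ne: "xs \<noteq> []" using xs(3) by auto
    \<comment> \<open>Needed to count n points. An inner vertex of the cup has a supporting line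
      below both ends, so it turns the wrong way for \<open>cap\<close>.\<close>
    have "y \<notin> set xs"
    proof
      assume y: "y \<in> set xs"
      moreover have "y \<noteq> hd xs" "y \<noteq> last xs" using xs(5,6) by auto
      ultimately obtain us vs where split: "xs = us @ y # vs" "us \<noteq> []" "vs \<noteq> []"
        by (metis append_Nil last_snoc list.sel(1) split_list)
      then obtain \<sigma> where \<sigma>: "\<And>r. r \<in> set (us @ vs) \<Longrightarrow> snd r - snd y > \<sigma> * (fst r - fst y)"
        using cup_supporting_line xs(1) by metis
      have "hd xs \<in> set (us @ vs)" "last xs \<in> set (us @ vs)" using split by auto
      note \<sigma> = this[THEN \<sigma>]
      have "slope (hd xs) y < \<sigma>" "\<sigma> < slope y (last xs)"
        using \<sigma> xs(5,6) by (auto simp: slope_def field_simps)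
      then show False using above by (simp add: cap_def)
    qed
    then have "card ({y} \<union> set xs) = k + 6" using xs chain_distinct distinct_card[of xs] by fastforce
    moreover have "convex_position ({y} \<union> set xs)"
      using above xs ne by (intro convex_position_cup_above[of xs "{y}" y]) auto
    ultimately show False using no_convex[of "{y} \<union> set xs"] xs by auto
  qed
  define S1 where "S1 = {p \<in> S. \<exists>ys. set ys \<subseteq> S \<and> length ys = k + 4 \<and> chain cap ys \<and> hd ys = p}"
  \<comment> \<open>The cups must lie inside \<open>S1\<close>, so that prolonging one by a point of
    \<open>S2\<close> contradicts \<open>no_cup1\<close>.\<close>
  define S2 where "S2 = {p \<in> S1. \<exists>xs. set xs \<subseteq> S1 \<and> length xs = k + 4 \<and> chain cup xs \<and> last xs = p}"
  have sub: "S1 \<subseteq> S" "S2 \<subseteq> S1" unfolding S1_def S2_def by auto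
  have free1: "chain_free cap (k + 4) (S - S1)"
    unfolding chain_free_def
  proof (intro allI impI notI)
    fix ys assume ys: "set ys \<subseteq> S - S1 \<and> length ys = k + 4" "chain cap ys"
    then have "hd ys \<in> set ys" by (intro hd_in_set) auto
    then show False using ys S1_def by blast
  qed
  have free2: "chain_free cup (k + 4) (S1 - S2)"
    unfolding chain_free_def
  proof (intro allI impI notI)
    fix xs assume xs: "set xs \<subseteq> S1 - S2 \<and> length xs = k + 4" "chain cup xs"
    then have "last xs \<in> set xs" by (intro last_in_set) auto
    then show False using xs S2_def by blast
  qed
  have no_cup1: "chain_free cup (k + 5) S1"
    unfolding chain_free_def
  proof (intro allI impI notI)
    fix xs assume xs: "set xs \<subseteq> S1 \<and> length xs = k + 5" "chain cup xs"
    then have "last xs \<in> S1" using last_in_set[of xs] by fastforce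
    then obtain ys where ys: "set ys \<subseteq> S" "length ys = k + 4" "chain cap ys" "hd ys = last xs"
      unfolding S1_def by auto
    obtain z where "z \<in> set ys" "chain cup (xs @ [z])"
      by (rule chain_extension[of S cup cap xs "k + 5" ys "k + 4"])
        (use xs ys sub no_cap' dich in auto)
    then show False using chain_freeD[OF no_cup, of "xs @ [z]"] xs ys sub by auto
  qed
  have no_cap2: "chain_free cap (k + 4) S2"
    unfolding chain_free_def
  proof (intro allI impI notI)
    fix ys assume ys: "set ys \<subseteq> S2 \<and> length ys = k + 4" "chain cap ys"
    then have "hd ys \<in> S2" using hd_in_set[of ys] by fastforce
    then obtain xs where xs: "set xs \<subseteq> S1" "length xs = k + 4" "chain cup xs" "last xs = hd ys"
      unfolding S2_def by auto
    obtain z where "z \<in> set ys" "chain cup (xs @ [z])"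
      by (rule chain_extension[of S cup cap xs "k + 4" ys "k + 4"])
        (use xs ys sub no_cap' dich in auto)
    then show False using chain_freeD[OF no_cup1, of "xs @ [z]"] xs ys sub by auto
  qed
  have no_cup2: "chain_free cup (k + 4) S2"
    unfolding chain_free_def
  proof (intro allI impI notI)
    fix Q assume Q: "set Q \<subseteq> S2 \<and> length Q = k + 4" "chain cup Q"
    then obtain Q0 t q where Q': "Q = Q0 @ [t, q]" using split_last2[of Q] by auto
    have mem: "hd Q \<in> S2" "t \<in> S2" "q \<in> S2" using Q Q' hd_in_set[of Q] by auto
    \<comment> \<open>As points of \<open>S1\<close>, the first and last points of \<open>Q\<close>
      start (n - 2)-caps; as points of \<open>S2\<close>, the first and the last but one end (n -
      2)-cups.\<close>
    obtain C1 where C1: "set C1 \<subseteq> S" "length C1 = k + 4" "chain cap C1" "hd C1 = hd Q"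
      using mem(1) sub unfolding S1_def by auto
    obtain C2 where C2: "set C2 \<subseteq> S" "length C2 = k + 4" "chain cap C2" "hd C2 = q"
      using mem(3) sub unfolding S1_def by auto
    obtain D1 where D1: "set D1 \<subseteq> S1" "length D1 = k + 4" "chain cup D1" "last D1 = hd Q"
      using mem(1) unfolding S2_def by auto
    obtain D2 where D2: "set D2 \<subseteq> S1" "length D2 = k + 4" "chain cup D2" "last D2 = t"
      using mem(2) unfolding S2_def by auto
    show False
    proof (rule five_chains_contradiction[of S "k + 4" Q "hd Q" Q0 t q C1 C2 D1 D2])
      show "chain_free cup (k + 4 + 2) S" using no_cup by (simp add: add.commute)
      show "chain_free cap (k + 4 + 1) S" using no_cap by (simp add: add.commute)
      show "\<not> cap (hd xs) y (last xs)"
        if "chain cup xs" "set xs \<subseteq> S" "length xs = k + 4 + 1" "y \<in> S"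
          "fst (hd xs) < fst y" "fst y < fst (last xs)" for xs y
        using no_cup_above[of xs y] that by simp
    qed (use Q Q' C1 C2 D1 D2 sub inj dich in auto)
  qed
  have bound: "card A \<le> (m + l) choose l"
    if "A \<subseteq> S" "chain_free cup m' A" "chain_free cap l' A" "m' = m + 2" "l' = l + 2" for A m m' l l'
  proof (rule cups_caps_bound[of A cup cap m l])
    show "finite A" using that(1) fin by (rule finite_subset)
    show "inj_on fst A" using inj that(1) by (rule inj_on_subset)
    show "cup x y z \<or> cap x y z" if "x \<in> A" "y \<in> A" "z \<in> A" "fst x < fst y" "fst y < fst z" for x y z
      using dich that \<open>A \<subseteq> S\<close> by blast
  qed (use that in auto)
  \<comment> \<open>Each upper index is split as \<open>m + l\<close>, where cups of size
    \<open>m + 2\<close> and caps of size \<open>l + 2\<close> are excluded.\<close>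
  have eqs: "2 * k + 6 = (k + 4) + (k + 2)" "2 * k + 5 = (k + 2) + (k + 3)" "2 * k + 4 = (k + 2) + (k + 2)"
    by simp_all
  have b1: "card (S - S1) \<le> (2 * k + 6) choose (k + 2)"
    unfolding eqs by (rule bound[OF Diff_subset chain_free_subset[OF no_cup Diff_subset] free1]) simp_all
  have b2: "card (S1 - S2) \<le> (2 * k + 5) choose (k + 3)"
  proof -
    have "S1 - S2 \<subseteq> S" using sub by blast
    then show ?thesis
      unfolding eqs by (intro bound[OF _ free2 chain_free_subset[OF no_cap]]) simp_all
  qed
  have b3: "card S2 \<le> (2 * k + 4) choose (k + 2)"
    unfolding eqs by (rule bound[OF subset_trans[OF sub(2,1)] no_cup2 no_cap2]) simp_all
  have "card S = card S2 + card (S1 - S2) + card (S - S1)"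
    using card_split_subset[OF fin sub(1)] card_split_subset[OF finite_subset[OF sub(1) fin] sub(2)] by simp
  then show ?thesis using b1 b2 b3 by linarith
qed

theorem theorem17:
  fixes n :: nat and S :: "(real \<times> real) set"
  assumes "n \<ge> 6"
    and "finite S"
    and "int (card S) =
      int ((2 * n - 6) choose (n - 3)) + int ((2 * n - 6) choose (n - 4))
        - int ((2 * n - 8) choose (n - 5)) + 1"
    and "non_vertical S"
    and "general_position S"
  shows "(\<exists>ps. set ps \<subseteq> S \<and> is_cap (n - 1) ps) \<or>
    (\<exists>P\<subseteq>S. card P = n \<and> convex_position P)"
proof (rule ccontr)
  assume neg: "\<not> ?thesis"
  obtain k where n: "n = k + 6" using assms(1) by (metis add.commute le_Suc_ex)
  have "card S \<le> ((2 * k + 6) choose (k + 2)) + ((2 * k + 5) choose (k + 3)) + ((2 * k + 4) choose (k + 2))"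
  proof (rule card_bound_convex_position_free)
    show "inj_on fst S" using assms(4) unfolding non_vertical_def inj_on_def by blast
    show "cup x y z \<or> cap x y z" if "x \<in> S" "y \<in> S" "z \<in> S" "fst x < fst y" "fst y < fst z" for x y z
    proof (rule ccontr)
      assume "\<not> ?thesis"
      then have "collinear {x, y, z}" using collinear_if_slope_eq that by (auto simp: cup_def cap_def)
      moreover have "x \<noteq> y" "y \<noteq> z" "x \<noteq> z" using that by auto
      ultimately show False using assms(5) that unfolding general_position_def by blast
    qed
    show "chain_free cap (k + 5) S"
      using neg is_cap_if_chain n unfolding chain_free_def by auto
    show "\<not> convex_position P" if "P \<subseteq> S" "card P = k + 6" for P using neg that n by blast
  qed (use assms in simp)
  \<comment> \<open>Pascal's rule is applied twice. The binomial that is subtracted in the assumed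
    size stands on the right, so the identity holds in the natural numbers.\<close>
  moreover have "((2 * k + 6) choose (k + 3)) + ((2 * k + 6) choose (k + 2)) =
      ((2 * k + 6) choose (k + 2)) + ((2 * k + 5) choose (k + 3)) + ((2 * k + 4) choose (k + 2)) + ((2 * k + 4) choose (k + 1))"
  proof -
    have "(2 * k + 6) choose (k + 3) = ((2 * k + 5) choose (k + 2)) + ((2 * k + 5) choose (k + 3))"
      using binomial_Suc_Suc[of "2 * k + 5" "k + 2"] by (simp add: numeral_eq_Suc)
    moreover have "(2 * k + 5) choose (k + 2) = ((2 * k + 4) choose (k + 1)) + ((2 * k + 4) choose (k + 2))"
      using binomial_Suc_Suc[of "2 * k + 4" "k + 1"] by (simp add: numeral_eq_Suc)
    ultimately show ?thesis by simp
  qed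
  moreover have eqs: "2 * n - 6 = 2 * k + 6" "2 * n - 8 = 2 * k + 4" "n - 3 = k + 3" "n - 4 = k + 2" "n - 5 = k + 1"
    using n by auto
  moreover note assms(3)[unfolded eqs]
  ultimately show False by linarith
qed

end
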